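(* Let $C, A_1,\dots,A_m$ be real symmetric $n\times n$ matrices and let $P = \{x \in \mathbb{R}^m : C - \sum_{i=1}^m A_i x_i \succeq 0\}$ be a full-dimensional spectrahedron that can be written in normal form, i.e. there are a non-singular matrix $M \in \mathbb{R}^{n\times n}$, an integer $\ell$ with $1 \le \ell \le n$, rational vectors $d, a_1,\dots,a_m \in \mathbb{Q}^\ell$ and real symmetric matrices $C', A_1',\dots,A_m'$ of order $n-\ell$ such that for all $x \in \mathbb{R}^m$ $$M\Big(C - \sum_{i=1}^m A_i x_i\Big)M^\top = \begin{bmatrix} C' - \sum_{i=1}^m A_i' x_i & 0 \\ 0 & \mathrm{Diag}(d) - \sum_{i=1}^m \mathrm{Diag}(a_i)x_i \end{bmatrix},$$ where $C' - \sum_{i=1}^m A_i' x_i$ cannot be further diagonalized. Let $Z \subseteq \mathbb{Z}^m$ be such that $$\max_x \{b^\top x : x \in P\} = \max_x \Big\{b^\top x : \mathrm{Diag}(d) - \sum_{i=1}^m \mathrm{Diag}(a_i) x_i \succeq 0\Big\}$$ for all $b \in Z$. Then there exists a linear matrix inequality describing $P$ (i.e. with solution set $P$) that is totally dual integral on $Z$.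
   Context: $[k]=\{1,\dots,k\}$, $\langle X,Y\rangle = \mathrm{tr}(X^\top Y)$, $\succeq 0$ denotes positive semidefinite, and $\mathrm{Diag}(v)$ is the diagonal matrix with diagonal $v$. "Cannot be further diagonalized" means that no congruence by a non-singular matrix brings $C' - \sum_i A_i' x_i$ (identically in $x$) to such a block-diagonal form with a diagonal lower-right block of size at least one. A linear matrix inequality describing $P$ may use symmetric matrices of any order. Property $(\mathrm{P}\mathbb{Z})_{\mathcal{V}}$: given a finite set $\mathcal{V} = \{V_1,\dots,V_k\}$ of positive semidefinite matrices (of the same order) with integer entries, a positive semidefinite matrix $X$ satisfies $(\mathrm{P}\mathbb{Z})_{\mathcal{V}}$ if $X = \sum_{j \in [k]} y_j V_j$ for some $y \in \mathbb{Z}^k_+$ (nonnegative integers). Total dual integrality: an LMI $\hat C - \sum_{i=1}^m \hat A_i x_i \succeq 0$ is totally dual integral on $Z \subseteq \mathbb{Z}^m$ if there exists a finite set $\mathcal{V}$ of integer positive semidefinite matrices such that, for every $b \in Z$, the dual semidefinite program $\inf\{\langle \hat C, X\rangle : \langle \hat A_i, X\rangle = b_i\ (i \in [m]),\ X \succeq 0\}$ of $\sup\{b^\top x : \hat C - \sum_{i} \hat A_i x_i \succeq 0\}$ has an optimal solution satisfying $(\mathrm{P}\mathbb{Z})_{\mathcal{V}}$ whenever it has an optimal solution. *)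

theory Defs
  imports "HOL-Analysis.Analysis" "Jordan_Normal_Form.Matrix"
begin

(* Matrix orders vary within a statement, so matrices are those of Jordan_Normal_Form,
   with the order carried by the dimensions.  The number m of variables is fixed, so
   points x, b are vectors of type real^'m and matrix families A_1, ..., A_m are
   functions of type 'm => real mat. *)

hide_const (open) Finite_Cartesian_Product.vec Finite_Cartesian_Product.mat

definition symmetric_of_order :: "nat \<Rightarrow> real mat \<Rightarrow> bool" where
  "symmetric_of_order n A \<longleftrightarrow> A \<in> carrier_mat n n \<and> transpose_mat A = A"

definition psd :: "nat \<Rightarrow> real mat \<Rightarrow> bool" where
  "psd n A \<longleftrightarrow> symmetric_of_order n A \<and>
     (\<forall>v \<in> carrier_vec n. 0 \<le> scalar_prod v (A *\<^sub>v v))"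

definition mat_inner :: "real mat \<Rightarrow> real mat \<Rightarrow> real" where
  "mat_inner X Y = (\<Sum>i<dim_row (transpose_mat X * Y). (transpose_mat X * Y) $$ (i, i))"

definition Diag :: "real vec \<Rightarrow> real mat" where
  "Diag v = mat_diag (dim_vec v) (vec_index v)"

(* C - (A_1 x_1 + ... + A_m x_m), written entrywise because matrices of varying
   dimension form no additive monoid over which a type-class sum could range. *)
definition pencil :: "real mat \<Rightarrow> ('m::finite \<Rightarrow> real mat) \<Rightarrow> real^'m \<Rightarrow> real mat" where
  "pencil C A x = mat (dim_row C) (dim_col C)
     (\<lambda>(r, s). C $$ (r, s) - (\<Sum>i\<in>UNIV. A i $$ (r, s) * vec_nth x i))"

definition spectrahedron :: "nat \<Rightarrow> real mat \<Rightarrow> ('m::finite \<Rightarrow> real mat) \<Rightarrow> (real^'m) set" where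
  "spectrahedron n C A = {x. psd n (pencil C A x)}"

definition block_diagonalizes ::
  "nat \<Rightarrow> real mat \<Rightarrow> ('m::finite \<Rightarrow> real mat) \<Rightarrow> real mat \<Rightarrow> nat \<Rightarrow>
   real mat \<Rightarrow> ('m \<Rightarrow> real mat) \<Rightarrow> real vec \<Rightarrow> ('m \<Rightarrow> real vec) \<Rightarrow> bool" where
  "block_diagonalizes n C A M l C' A' d a \<longleftrightarrow>
     M \<in> carrier_mat n n \<and> invertible_mat M \<and>
     1 \<le> l \<and> l \<le> n \<and>
     symmetric_of_order (n - l) C' \<and> (\<forall>i. symmetric_of_order (n - l) (A' i)) \<and>
     d \<in> carrier_vec l \<and> (\<forall>i. a i \<in> carrier_vec l) \<and>
     (\<forall>x. M * pencil C A x * transpose_mat M =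
        four_block_mat (pencil C' A' x) (0\<^sub>m (n - l) l)
                       (0\<^sub>m l (n - l)) (pencil (Diag d) (\<lambda>i. Diag (a i)) x))"

(* The diagonal block split off here may have arbitrary real entries. *)
definition further_diagonalizable :: "nat \<Rightarrow> real mat \<Rightarrow> ('m::finite \<Rightarrow> real mat) \<Rightarrow> bool" where
  "further_diagonalizable n C A \<longleftrightarrow>
     (\<exists>M l C' A' d a. block_diagonalizes n C A M l C' A' d a)"

definition rational_vec :: "real vec \<Rightarrow> bool" where
  "rational_vec v \<longleftrightarrow> (\<forall>k<dim_vec v. v $ k \<in> \<rat>)"

definition normal_form ::
  "nat \<Rightarrow> real mat \<Rightarrow> ('m::finite \<Rightarrow> real mat) \<Rightarrow> real mat \<Rightarrow> nat \<Rightarrow>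
   real mat \<Rightarrow> ('m \<Rightarrow> real mat) \<Rightarrow> real vec \<Rightarrow> ('m \<Rightarrow> real vec) \<Rightarrow> bool" where
  "normal_form n C A M l C' A' d a \<longleftrightarrow>
     block_diagonalizes n C A M l C' A' d a \<and>
     rational_vec d \<and> (\<forall>i. rational_vec (a i)) \<and>
     \<not> further_diagonalizable (n - l) C' A'"

definition integer_mat :: "real mat \<Rightarrow> bool" where
  "integer_mat V \<longleftrightarrow> (\<forall>r<dim_row V. \<forall>s<dim_col V. V $$ (r, s) \<in> \<int>)"

definition PZ :: "nat \<Rightarrow> real mat set \<Rightarrow> real mat \<Rightarrow> bool" where
  "PZ n \<V> X \<longleftrightarrow> psd n X \<and>
     (\<exists>y :: real mat \<Rightarrow> nat. X = mat n n (\<lambda>(r, s). \<Sum>V\<in>\<V>. real (y V) * V $$ (r, s)))"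

definition dual_feasible ::
  "nat \<Rightarrow> ('m::finite \<Rightarrow> real mat) \<Rightarrow> real^'m \<Rightarrow> real mat \<Rightarrow> bool" where
  "dual_feasible n A b X \<longleftrightarrow> psd n X \<and> (\<forall>i. mat_inner (A i) X = vec_nth b i)"

definition dual_optimal ::
  "nat \<Rightarrow> real mat \<Rightarrow> ('m::finite \<Rightarrow> real mat) \<Rightarrow> real^'m \<Rightarrow> real mat \<Rightarrow> bool" where
  "dual_optimal n C A b X \<longleftrightarrow> dual_feasible n A b X \<and>
     (\<forall>Y. dual_feasible n A b Y \<longrightarrow> mat_inner C X \<le> mat_inner C Y)"

definition TDI_on ::
  "nat \<Rightarrow> real mat \<Rightarrow> ('m::finite \<Rightarrow> real mat) \<Rightarrow> (real^'m) set \<Rightarrow> bool" where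
  "TDI_on n C A Z \<longleftrightarrow>
     (\<exists>\<V>. finite \<V> \<and> (\<forall>V\<in>\<V>. psd n V \<and> integer_mat V) \<and>
        (\<forall>b\<in>Z. (\<exists>X. dual_optimal n C A b X) \<longrightarrow>
                (\<exists>X. dual_optimal n C A b X \<and> PZ n \<V> X)))"

(* The value max {b^T x : x in S} with the usual convention that it is infinite when the
   objective is unbounded; equal to the maximum whenever that is attained. *)
definition max_value :: "real^'m \<Rightarrow> (real^'m::finite) set \<Rightarrow> ereal" where
  "max_value b S = (SUP x\<in>S. ereal (inner b x))"

end

(* The diagonal block of the normal form describes a rational polyhedron Q that contains P.
   A basic optimal dual solution y of the linear program over Q is supported on linearly
   independent rows, and since the rows are rational there is a single D > 0 such that D y is
   integral for every integral objective.  Add to the original inequality of P the redundant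
   rows of Q, divided by D.  Divided rows have dual solutions multiplied by D, so diagonal dual
   matrices with nonnegative integer entries attain the optimum over Q; by hypothesis this is
   the optimum over P, and weak duality makes them optimal for the semidefinite dual. *)

theory Submission
  imports Defs
begin

text \<open>The given pencil already contains the rows of Q, but only through M: a multiplier vector
  y for Q corresponds there to the dual matrix M^T Diag(0,y) M, whose real entries have no reason to
  be integral. Repeating the rows in a block of their own gives the multipliers fresh diagonal
  coordinates, where integrality of y is integrality of the matrix.

  The denominator must not depend on b. Multipliers supported on independent rows are determined by
  the support and b, through linear functionals with rational coefficients; a denominator of these
  coefficients serves every integral b, and there are only finitely many supports.

  The bound that feeds LP duality comes from the given dual optimum X: by weak duality its cost
  bounds the objective over P, the hypothesis carries this bound to Q, and LP duality answers with
  multipliers of cost at most that of X.\<close>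

no_notation scalar_prod (infix "\<bullet>" 70)

section \<open>Linear programming duality and basic solutions\<close>

text \<open>Farkas by separation: a finitely generated cone is closed, so if (b, \<mu>) lay outside
  the cone of the rows, the separating functional would produce a feasible point whose objective
  exceeds \<mu>.\<close>

lemma lp_dual_exists:
  fixes \<alpha> :: "'k \<Rightarrow> 'a::euclidean_space" and \<delta> :: "'k \<Rightarrow> real"
  assumes fin: "finite K"
    and feasible: "\<forall>k\<in>K. \<alpha> k \<bullet> x\<^sub>0 \<le> \<delta> k"
    and bound: "\<And>x. \<forall>k\<in>K. \<alpha> k \<bullet> x \<le> \<delta> k \<Longrightarrow> b \<bullet> x \<le> \<mu>"
  shows "\<exists>y. (\<forall>k\<in>K. 0 \<le> y k) \<and> (\<Sum>k\<in>K. y k *\<^sub>R \<alpha> k) = b \<and> (\<Sum>k\<in>K. y k * \<delta> k) \<le> \<mu>"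
proof -
  \<comment> \<open>The generator (0, 1) absorbs slack, so membership of (b, \<mu>) expresses cost
    at most \<mu>; it also forces the last coordinate of a separating functional to be
    nonnegative.\<close>
  define G where "G = insert (0, 1) ((\<lambda>k. (\<alpha> k, \<delta> k)) ` K)"
  define H where "H = {p. \<exists>y s. (\<forall>k\<in>K. 0 \<le> y k) \<and> 0 \<le> s \<and>
    p = ((\<Sum>k\<in>K. y k *\<^sub>R \<alpha> k), (\<Sum>k\<in>K. y k * \<delta> k) + s)}"
  have "convex_cone H"
    unfolding convex_cone_iff
  proof (intro conjI ballI allI impI)
    show "0 \<in> H"
      unfolding H_def by (intro CollectI exI[of _ "\<lambda>_. 0"] exI[of _ 0]) (simp add: zero_prod_def)
  next
    fix p q assume "p \<in> H" "q \<in> H"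
    then obtain y s y' s' where
      "\<forall>k\<in>K. 0 \<le> y k" "0 \<le> s" "p = ((\<Sum>k\<in>K. y k *\<^sub>R \<alpha> k), (\<Sum>k\<in>K. y k * \<delta> k) + s)"
      "\<forall>k\<in>K. 0 \<le> y' k" "0 \<le> s'" "q = ((\<Sum>k\<in>K. y' k *\<^sub>R \<alpha> k), (\<Sum>k\<in>K. y' k * \<delta> k) + s')"
      unfolding H_def by blast
    then show "p + q \<in> H"
      unfolding H_def
      by (intro CollectI exI[of _ "\<lambda>k. y k + y' k"] exI[of _ "s + s'"])
        (simp add: scaleR_add_left sum.distrib distrib_right)
  next
    fix p and c :: real assume "p \<in> H" "0 \<le> c"
    then obtain y s where
      "\<forall>k\<in>K. 0 \<le> y k" "0 \<le> s" "p = ((\<Sum>k\<in>K. y k *\<^sub>R \<alpha> k), (\<Sum>k\<in>K. y k * \<delta> k) + s)"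
      unfolding H_def by blast
    with \<open>0 \<le> c\<close> show "c *\<^sub>R p \<in> H"
      unfolding H_def
      by (intro CollectI exI[of _ "\<lambda>k. c * y k"] exI[of _ "c * s"])
        (simp add: scaleR_sum_right sum_distrib_left distrib_left mult.assoc)
  qed
  moreover have "G \<subseteq> H"
  proof -
    have "(0, 1) \<in> H"
      unfolding H_def by (intro CollectI exI[of _ "\<lambda>_. 0"] exI[of _ 1]) simp
    moreover have "(\<alpha> k, \<delta> k) \<in> H" if "k \<in> K" for k
      unfolding H_def
      by (intro CollectI exI[of _ "\<lambda>j. if j = k then 1 else 0"] exI[of _ 0])
        (use that fin in \<open>simp add: if_distrib[of "\<lambda>c. c *\<^sub>R _"] if_distrib[of "\<lambda>c. c * _"] cong: if_cong\<close>)
    ultimately show ?thesis unfolding G_def by auto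
  qed
  ultimately have hull: "convex_cone hull G \<subseteq> H"
    by (rule hull_minimal[OF _ , rotated])
  have "(b, \<mu>) \<in> convex_cone hull G"
  proof (rule ccontr)
    assume "(b, \<mu>) \<notin> convex_cone hull G"
    moreover have "closed (convex_cone hull G)"
      using fin by (intro closed_convex_cone_hull) (simp add: G_def)
    ultimately obtain p c where p: "p \<bullet> (b, \<mu>) < c" "\<forall>z\<in>convex_cone hull G. c < p \<bullet> z"
      using separating_hyperplane_closed_point convex_convex_cone_hull by metis
    have "c < 0"
      using p(2) convex_cone_hull_contains_0[of G] by fastforce
    have nonneg: "0 \<le> p \<bullet> z" if z: "z \<in> G" for z
    proof (rule ccontr)
      assume neg: "\<not> 0 \<le> p \<bullet> z"
      \<comment> \<open>This positive multiple of \<open>z\<close> has value exactly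
        \<open>c\<close>, while the cone lies strictly above \<open>c\<close>.\<close>
      have "(c / (p \<bullet> z)) *\<^sub>R z \<in> convex_cone hull G"
        using neg \<open>c < 0\<close> hull_inc[OF z] by (intro convex_cone_hull_mul) (auto simp: divide_nonpos_neg)
      then have "c < p \<bullet> ((c / (p \<bullet> z)) *\<^sub>R z)"
        using p(2) by blast
      then show False using neg by simp
    qed
    obtain u t where ut: "p = (u, t)" by fastforce
    have t: "0 \<le> t" using nonneg[of "(0, 1)"] ut by (simp add: G_def)
    have u: "0 \<le> u \<bullet> \<alpha> k + t * \<delta> k" if "k \<in> K" for k
      using nonneg[of "(\<alpha> k, \<delta> k)"] that ut by (simp add: G_def)
    have b: "u \<bullet> b + t * \<mu> < 0" using p(1) \<open>c < 0\<close> ut by simp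
    show False
    proof (cases "t = 0")
      case False
      with t have "0 < t" by simp
      \<comment> \<open>By \<open>b\<close>, the objective at \<open>-u / t\<close> exceeds
        \<mu>.\<close>
      have "\<forall>k\<in>K. \<alpha> k \<bullet> ((-1 / t) *\<^sub>R u) \<le> \<delta> k"
      proof
        fix k assume "k \<in> K"
        then show "\<alpha> k \<bullet> ((-1 / t) *\<^sub>R u) \<le> \<delta> k"
          using u[of k] \<open>0 < t\<close> by (simp add: inner_commute field_simps)
      qed
      from bound[OF this] show False
        using b \<open>0 < t\<close> by (simp add: inner_commute field_simps)
    next
      case True
      \<comment> \<open>With \<open>t = 0\<close>, moving along \<open>- u\<close> keeps every
        constraint and increases the objective; \<open>s\<close> is the step from
        \<open>x\<^sub>0\<close> that reaches the value \<mu> + 1.\<close>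
      define s where "s = (\<mu> - b \<bullet> x\<^sub>0 + 1) / (- (u \<bullet> b))"
      have ub: "u \<bullet> b < 0" using b True by simp
      have "0 \<le> s" using bound[OF feasible] ub by (simp add: s_def divide_nonneg_neg)
      have "\<forall>k\<in>K. \<alpha> k \<bullet> (x\<^sub>0 - s *\<^sub>R u) \<le> \<delta> k"
      proof
        fix k assume k: "k \<in> K"
        have "0 \<le> s * (\<alpha> k \<bullet> u)"
          using u[OF k] True \<open>0 \<le> s\<close> by (simp add: inner_commute)
        then show "\<alpha> k \<bullet> (x\<^sub>0 - s *\<^sub>R u) \<le> \<delta> k"
          using feasible k by (auto simp: inner_diff_right intro: order_trans)
      qed
      from bound[OF this] have "b \<bullet> x\<^sub>0 - s * (u \<bullet> b) \<le> \<mu>"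
        by (simp add: inner_diff_right inner_commute)
      moreover have "s * (u \<bullet> b) = - (\<mu> - b \<bullet> x\<^sub>0 + 1)"
        using ub by (simp add: s_def)
      ultimately show False by simp
    qed
  qed
  with hull have "(b, \<mu>) \<in> H" by blast
  then show ?thesis unfolding H_def by auto
qed

text \<open>The last conjunct makes \<open>y\<close> unique for its support, which is what later
  turns rationality of the rows into a bound on denominators.\<close>

lemma lp_dual_basic:
  fixes \<alpha> :: "'k \<Rightarrow> 'a::euclidean_space" and \<delta> :: "'k \<Rightarrow> real"
  assumes fin: "finite K"
    and feasible: "\<forall>k\<in>K. \<alpha> k \<bullet> x\<^sub>0 \<le> \<delta> k"
    and bound: "\<And>x. \<forall>k\<in>K. \<alpha> k \<bullet> x \<le> \<delta> k \<Longrightarrow> b \<bullet> x \<le> \<mu>"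
  shows "\<exists>y. (\<forall>k\<in>K. 0 \<le> y k) \<and> (\<Sum>k\<in>K. y k *\<^sub>R \<alpha> k) = b \<and> (\<Sum>k\<in>K. y k * \<delta> k) \<le> \<mu> \<and>
    (\<forall>z. (\<Sum>k\<in>{k\<in>K. y k \<noteq> 0}. z k *\<^sub>R \<alpha> k) = 0 \<longrightarrow> (\<forall>k\<in>{k\<in>K. y k \<noteq> 0}. z k = 0))"
proof -
  define F where "F y \<longleftrightarrow> (\<forall>k\<in>K. 0 \<le> y k) \<and> (\<Sum>k\<in>K. y k *\<^sub>R \<alpha> k) = b \<and> (\<Sum>k\<in>K. y k * \<delta> k) \<le> \<mu>"
    for y
  obtain y where F: "F y" and
    min: "\<And>y'. F y' \<Longrightarrow> card {k\<in>K. y k \<noteq> 0} \<le> card {k\<in>K. y' k \<noteq> 0}"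
    using lp_dual_exists[OF assms] ex_has_least_nat[of F _ "\<lambda>y. card {k\<in>K. y k \<noteq> 0}"]
    unfolding F_def by blast
  define S where "S = {k\<in>K. y k \<noteq> 0}"
  have SK: "S \<subseteq> K" "finite S" using fin by (auto simp: S_def)
  \<comment> \<open>A linear dependence on the support of \<open>y\<close> could be followed, in a direction that
    does not increase the cost, until a component vanishes, against the minimality of the support.\<close>
  have "z k\<^sub>0 = 0" if z0: "(\<Sum>k\<in>S. z k *\<^sub>R \<alpha> k) = 0" and k0: "k\<^sub>0 \<in> S" for z k\<^sub>0
  proof (rule ccontr)
    assume nz: "z k\<^sub>0 \<noteq> 0"
    \<comment> \<open>Pairing the dependence with the feasible point gives the sign. Hence a
      dependence of negative cost must have a negative entry.\<close>
    have pos: "0 \<le> (\<Sum>k\<in>S. w k * \<delta> k)"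
      if "(\<Sum>k\<in>S. w k *\<^sub>R \<alpha> k) = 0" "\<forall>k\<in>S. 0 \<le> w k" for w
    proof -
      have "0 = (\<Sum>k\<in>S. w k *\<^sub>R \<alpha> k) \<bullet> x\<^sub>0" using that by simp
      also have "\<dots> = (\<Sum>k\<in>S. w k * (\<alpha> k \<bullet> x\<^sub>0))" by (simp add: inner_sum_left)
      also have "\<dots> \<le> (\<Sum>k\<in>S. w k * \<delta> k)"
        using that feasible SK by (intro sum_mono mult_left_mono) auto
      finally show ?thesis .
    qed
    \<comment> \<open>One of \<open>z\<close> and \<open>- z\<close> has cost at most 0. If that
      cost is negative, \<open>pos\<close> supplies the negative entry; if it is 0, the sign is
      chosen so that the entry at \<open>k\<^sub>0\<close> is negative.\<close>
    have "\<exists>w. (\<Sum>k\<in>S. w k *\<^sub>R \<alpha> k) = 0 \<and> (\<Sum>k\<in>S. w k * \<delta> k) \<le> 0 \<and> (\<exists>k\<in>S. w k < 0)"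
    proof -
      consider "(\<Sum>k\<in>S. z k * \<delta> k) < 0" | "(\<Sum>k\<in>S. z k * \<delta> k) > 0"
        | "(\<Sum>k\<in>S. z k * \<delta> k) = 0" "z k\<^sub>0 < 0" | "(\<Sum>k\<in>S. z k * \<delta> k) = 0" "z k\<^sub>0 > 0"
        using nz by linarith
      then show ?thesis
      proof cases
        case 1
        with pos[OF z0] show ?thesis
          by (intro exI[of _ z]) (use z0 in force)
      next
        case 2
        with pos[of "\<lambda>k. - z k"] show ?thesis
          by (intro exI[of _ "\<lambda>k. - z k"]) (use z0 in \<open>force simp: sum_negf\<close>)
      next
        case 3
        then show ?thesis using z0 k0 by (intro exI[of _ z]) auto
      next
        case 4
        then show ?thesis using z0 k0
          by (intro exI[of _ "\<lambda>k. - z k"]) (auto simp: sum_negf)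
      qed
    qed
    then obtain w where w: "(\<Sum>k\<in>S. w k *\<^sub>R \<alpha> k) = 0" "(\<Sum>k\<in>S. w k * \<delta> k) \<le> 0"
      and ex: "\<exists>k\<in>S. w k < 0" by blast
    define N where "N = {k\<in>S. w k < 0}"
    have N: "finite N" "N \<noteq> {}" using ex SK by (auto simp: N_def)
    \<comment> \<open>The ratio test of the simplex method: the longest step along \<open>w\<close>
      that keeps \<open>y\<close> nonnegative. At an index attaining the minimum the new component
      is 0.\<close>
    define t where "t = Min ((\<lambda>k. y k / - w k) ` N)"
    have "t \<in> (\<lambda>k. y k / - w k) ` N" unfolding t_def using N by (intro Min_in) auto
    then obtain k\<^sub>1 where k1: "k\<^sub>1 \<in> N" "t = y k\<^sub>1 / - w k\<^sub>1" by blast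
    have tle: "t \<le> y k / - w k" if "k \<in> N" for k
      unfolding t_def using N that by (intro Min_le) auto
    have y0: "\<forall>k\<in>K. 0 \<le> y k" using F by (simp add: F_def)
    have t0: "0 \<le> t"
      using k1 y0 SK by (auto simp: N_def divide_nonneg_neg intro!: divide_nonneg_pos)
    define y' where "y' k = (if k \<in> S then y k + t * w k else y k)" for k
    \<comment> \<open>A general \<open>g\<close> lets one computation serve both the vector sum and
      the cost.\<close>
    have y'_sum: "(\<Sum>k\<in>K. g (y' k) k) = (\<Sum>k\<in>K. g (y k) k) + (\<Sum>k\<in>S. t *\<^sub>R g (w k) k)"
      if g: "\<And>r s k. g (r + t * s) k = g r k + t *\<^sub>R g s k"
      for g :: "real \<Rightarrow> 'k \<Rightarrow> 'c::real_vector"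
    proof -
      have "(\<Sum>k\<in>K. g (y' k) k) = (\<Sum>k\<in>K. g (y k) k + (if k \<in> S then t *\<^sub>R g (w k) k else 0))"
        by (intro sum.cong refl) (simp add: y'_def g)
      also have "\<dots> = (\<Sum>k\<in>K. g (y k) k) + (\<Sum>k\<in>K \<inter> S. t *\<^sub>R g (w k) k)"
        by (simp add: sum.distrib sum.inter_restrict[OF fin])
      also have "K \<inter> S = S" using SK by blast
      finally show ?thesis .
    qed
    have "F y'"
      unfolding F_def
    proof (intro conjI ballI)
      fix k assume k: "k \<in> K"
      show "0 \<le> y' k"
      proof (cases "k \<in> N")
        case True
        then have "t * - w k \<le> y k" using tle[OF True] by (simp add: N_def field_simps)
        then show ?thesis using k y0 by (simp add: y'_def)
      next
        case False
        then show ?thesis using k y0 t0 by (auto simp: y'_def N_def not_less)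
      qed
    next
      show "(\<Sum>k\<in>K. y' k *\<^sub>R \<alpha> k) = b"
        using y'_sum[of "\<lambda>r k. r *\<^sub>R \<alpha> k", OF scaleR_add_left[of _ "t * _", unfolded scaleR_scaleR[symmetric]]] w F
        by (simp add: F_def del: scaleR_scaleR flip: scaleR_sum_right)
      have "(\<Sum>k\<in>K. y' k * \<delta> k) = (\<Sum>k\<in>K. y k * \<delta> k) + t * (\<Sum>k\<in>S. w k * \<delta> k)"
        using y'_sum[of "\<lambda>r k. r * \<delta> k"]
        by (simp add: distrib_right mult.assoc flip: sum_distrib_left)
      moreover have "t * (\<Sum>k\<in>S. w k * \<delta> k) \<le> 0"
        using t0 w(2) by (simp add: mult_nonneg_nonpos)
      ultimately show "(\<Sum>k\<in>K. y' k * \<delta> k) \<le> \<mu>" using F by (simp add: F_def)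
    qed
    moreover have "{k\<in>K. y' k \<noteq> 0} \<subset> S"
    proof -
      have "y' k\<^sub>1 = 0" "k\<^sub>1 \<in> S" using k1 by (auto simp: y'_def N_def)
      then show ?thesis by (auto simp: y'_def S_def split: if_splits)
    qed
    ultimately show False
      using min[of y'] psubset_card_mono[OF SK(2), of "{k\<in>K. y' k \<noteq> 0}"]
      unfolding S_def by linarith
  qed
  then have "\<forall>z. (\<Sum>k\<in>S. z k *\<^sub>R \<alpha> k) = 0 \<longrightarrow> (\<forall>k\<in>S. z k = 0)" by simp
  with F show ?thesis unfolding F_def S_def by (intro exI[of _ y]) (elim conjE, intro conjI)
qed

section \<open>Bounded denominators\<close>

text \<open>In the reals as a vector space over the rationals the set {1} is independent, so a
  rational-valued linear functional with value 1 at 1 exists by extension to a basis.\<close>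

lemma rational_linear_retraction:
  "\<exists>\<phi> :: real \<Rightarrow> real. (\<forall>x y. \<phi> (x + y) = \<phi> x + \<phi> y) \<and>
    (\<forall>q\<in>\<rat>. \<forall>x. \<phi> (q * x) = q * \<phi> x) \<and> \<phi> 1 = 1 \<and> (\<forall>x. \<phi> x \<in> \<rat>)"
proof -
  interpret vector_space_pair "\<lambda>(q::rat) (x::real). of_rat q * x" "\<lambda>(q::rat) (x::rat). q * x"
    by unfold_locales (auto simp: algebra_simps of_rat_add of_rat_mult)
  have "vs1.independent {1}" by simp
  from linear_independent_extend[OF this, of "\<lambda>_. 1"] obtain g where
    g: "Vector_Spaces.linear (\<lambda>(q::rat) (x::real). of_rat q * x) (*) g" "g 1 = 1" by auto
  interpret g: Vector_Spaces.linear "\<lambda>(q::rat) (x::real). of_rat q * x" "(*)" g by (rule g(1))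
  show ?thesis
  proof (intro exI[of _ "\<lambda>x. of_rat (g x)"] conjI allI ballI)
    fix q x :: real assume "q \<in> \<rat>"
    then obtain r where "q = of_rat r" by (rule Rats_cases)
    then show "of_rat (g (q * x)) = q * (of_rat (g x) :: real)"
      using g.scale[of r x] by (simp add: of_rat_mult)
  qed (simp_all add: g.add of_rat_add g(2))
qed

text \<open>Independence of an indexed family also excludes repetitions, so it passes to the image
  set, on which the values of a linear functional may be prescribed freely.\<close>

lemma dual_functional_of_independent_family:
  fixes \<alpha> :: "'k \<Rightarrow> 'a::real_vector"
  assumes fin: "finite S"
    and ind: "\<And>z. (\<Sum>k\<in>S. z k *\<^sub>R \<alpha> k) = 0 \<Longrightarrow> \<forall>k\<in>S. z k = 0"
    and k: "k \<in> S"
  shows "\<exists>f :: 'a \<Rightarrow> real. linear f \<and> (\<forall>j\<in>S. f (\<alpha> j) = (if j = k then 1 else 0))"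
proof -
  have inj: "inj_on \<alpha> S"
  proof (rule inj_onI, rule ccontr)
    fix i j assume ij: "i \<in> S" "j \<in> S" "\<alpha> i = \<alpha> j" "i \<noteq> j"
    have "(\<Sum>k\<in>S. ((if k = i then 1 else 0) - (if k = j then 1 else 0)) *\<^sub>R \<alpha> k) =
        (\<Sum>k\<in>S. (if k = i then \<alpha> k else 0)) - (\<Sum>k\<in>S. (if k = j then \<alpha> k else 0))"
      by (subst sum_subtractf[symmetric], intro sum.cong) auto
    also have "\<dots> = 0" using ij fin by simp
    finally have "\<forall>k\<in>S. (if k = i then 1 else 0) - (if k = j then 1 else 0) = (0::real)"
      by (rule ind)
    with ij show False by fastforce
  qed
  have "independent (\<alpha> ` S)"
  proof
    assume "dependent (\<alpha> ` S)"
    then obtain u where u: "\<exists>v\<in>\<alpha> ` S. u v \<noteq> 0" "(\<Sum>v\<in>\<alpha> ` S. u v *\<^sub>R v) = 0"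
      using fin by (auto simp: dependent_finite)
    then have "(\<Sum>k\<in>S. u (\<alpha> k) *\<^sub>R \<alpha> k) = 0" by (simp add: sum.reindex[OF inj])
    from ind[OF this] u(1) show False by auto
  qed
  from linear_independent_extend[OF this, of "\<lambda>v. if v = \<alpha> k then 1 else 0"]
  obtain f where "linear f" "\<forall>v\<in>\<alpha> ` S. f v = (if v = \<alpha> k then 1 else (0::real))" by blast
  then show ?thesis using inj k by (intro exI[of _ f]) (auto dest: inj_onD)
qed

lemma common_denominator:
  assumes "finite Q" "Q \<subseteq> (\<rat> :: real set)"
  shows "\<exists>D::nat. 0 < D \<and> (\<forall>q\<in>Q. real D * q \<in> \<int>)"
  using assms
proof (induction Q)
  case (insert q Q)
  then obtain D where D: "0 < D" "\<forall>q\<in>Q. real D * q \<in> \<int>" by auto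
  obtain m n :: int where mn: "n > 0" "q = of_int m / of_int n"
    using insert.prems by (auto elim: Rats_cases')
  have "real (D * nat n) * q = of_int (int D * m)" using mn by simp
  then have "real (D * nat n) * q \<in> \<int>" by (metis Ints_of_int)
  moreover have "real (D * nat n) * r \<in> \<int>" if "r \<in> Q" for r
  proof -
    have "real (D * nat n) * r = real (nat n) * (real D * r)" by simp
    then show ?thesis using D(2) that by (metis Ints_mult Ints_of_nat)
  qed
  ultimately show ?case using D(1) mn(1) by (intro exI[of _ "D * nat n"]) auto
next
  case empty
  show ?case by (intro exI[of _ 1]) simp
qed

text \<open>A functional dual to the independent family need not have rational coefficients; composing
  them with a rational-linear retraction of the reals onto the rationals makes them rational and
  keeps the duality, because the family itself is rational.\<close>

lemma bounded_denominator_independent: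
  fixes \<alpha> :: "'k \<Rightarrow> real^'m::finite"
  assumes fin: "finite S"
    and rat: "\<And>k i. k \<in> S \<Longrightarrow> vec_nth (\<alpha> k) i \<in> \<rat>"
    and ind: "\<And>z. (\<Sum>k\<in>S. z k *\<^sub>R \<alpha> k) = 0 \<Longrightarrow> \<forall>k\<in>S. z k = 0"
  shows "\<exists>D::nat. 0 < D \<and> (\<forall>y. (\<forall>i. vec_nth (\<Sum>k\<in>S. y k *\<^sub>R \<alpha> k) i \<in> \<int>) \<longrightarrow>
    (\<forall>k\<in>S. real D * y k \<in> \<int>))"
proof -
  obtain \<phi> :: "real \<Rightarrow> real" where \<phi>: "\<And>x y. \<phi> (x + y) = \<phi> x + \<phi> y"
    "\<And>q x. q \<in> \<rat> \<Longrightarrow> \<phi> (q * x) = q * \<phi> x" "\<phi> 1 = 1" "\<And>x. \<phi> x \<in> \<rat>"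
    using rational_linear_retraction by blast
  have \<phi>0: "\<phi> 0 = 0" using \<phi>(1)[of 0 0] by simp
  have \<phi>_sum: "\<phi> (sum h I) = (\<Sum>i\<in>I. \<phi> (h i))" if "finite I" for h :: "'m \<Rightarrow> real" and I
    using that by (induction I) (auto simp: \<phi>0 \<phi>(1))
  have "\<exists>f :: real^'m \<Rightarrow> real. linear f \<and> (\<forall>j\<in>S. f (\<alpha> j) = (if j = k then 1 else 0))"
    if "k \<in> S" for k
    using dual_functional_of_independent_family[OF fin ind that] .
  then obtain f where f: "\<And>k. k \<in> S \<Longrightarrow> linear (f k :: real^'m \<Rightarrow> real)"
    "\<And>k j. k \<in> S \<Longrightarrow> j \<in> S \<Longrightarrow> f k (\<alpha> j) = (if j = k then 1 else 0)"
    by metis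
  define c where "c k i = \<phi> (f k (axis i 1))" for k i
  have dual: "(\<Sum>i\<in>UNIV. vec_nth (\<alpha> j) i * c k i) = (if j = k then 1 else 0)"
    if "k \<in> S" "j \<in> S" for j k
  proof -
    have "(\<Sum>i\<in>UNIV. vec_nth (\<alpha> j) i * c k i) = \<phi> (\<Sum>i\<in>UNIV. vec_nth (\<alpha> j) i * f k (axis i 1))"
      by (simp add: \<phi>_sum c_def \<phi>(2) rat[OF that(2)])
    also have "(\<Sum>i\<in>UNIV. vec_nth (\<alpha> j) i * f k (axis i 1)) = f k (\<alpha> j)"
    proof -
      have "f k (\<alpha> j) = f k (\<Sum>i\<in>UNIV. vec_nth (\<alpha> j) i *s axis i 1)"
        by (simp add: basis_expansion)
      also have "\<dots> = (\<Sum>i\<in>UNIV. vec_nth (\<alpha> j) i * f k (axis i 1))"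
        using f(1)[OF that(1)]
        by (simp add: linear_sum linear_scale scalar_mult_eq_scaleR)
      finally show ?thesis by simp
    qed
    finally show ?thesis using f(2)[OF that] by (simp add: \<phi>0 \<phi>(3))
  qed
  have "finite ((\<lambda>(k, i). c k i) ` (S \<times> UNIV))" using fin by simp
  then obtain D :: nat where D: "0 < D" "\<forall>q\<in>(\<lambda>(k, i). c k i) ` (S \<times> UNIV). real D * q \<in> \<int>"
    using common_denominator[of "(\<lambda>(k, i). c k i) ` (S \<times> UNIV)"] \<phi>(4)
    by (metis (no_types, lifting) c_def case_prod_conv image_subsetI surj_pair)
  show ?thesis
  proof (intro exI[of _ D] conjI D(1) allI impI ballI)
    fix y k assume int: "\<forall>i. vec_nth (\<Sum>k\<in>S. y k *\<^sub>R \<alpha> k) i \<in> \<int>" and k: "k \<in> S"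
    \<comment> \<open>The functional with coefficients \<open>c k\<close> extracts
      \<open>y k\<close> from the combination. Scaled by \<open>D\<close> its coefficients are
      integers, so \<open>D * y k\<close> is an integral combination of integral entries.\<close>
    have "(\<Sum>i\<in>UNIV. vec_nth (\<Sum>j\<in>S. y j *\<^sub>R \<alpha> j) i * (real D * c k i)) =
        (\<Sum>i\<in>UNIV. \<Sum>j\<in>S. real D * y j * (vec_nth (\<alpha> j) i * c k i))"
      by (simp add: sum_distrib_right sum_distrib_left mult_ac)
    also have "\<dots> = (\<Sum>j\<in>S. real D * y j * (\<Sum>i\<in>UNIV. vec_nth (\<alpha> j) i * c k i))"
      by (subst sum.swap) (simp add: sum_distrib_left)
    also have "\<dots> = (\<Sum>j\<in>S. if j = k then real D * y j else 0)"
      using k by (intro sum.cong) (auto simp: dual)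
    also have "\<dots> = real D * y k" using fin k by simp
    finally have eq: "real D * y k = (\<Sum>i\<in>UNIV. vec_nth (\<Sum>j\<in>S. y j *\<^sub>R \<alpha> j) i * (real D * c k i))"
      by simp
    have Dc: "real D * c k i \<in> \<int>" for i using D(2) k by auto
    show "real D * y k \<in> \<int>"
      unfolding eq by (rule Ints_sum, rule Ints_mult[OF int[rule_format] Dc])
  qed
qed

lemma lp_dual_bounded_denominator:
  fixes \<alpha> :: "'k \<Rightarrow> real^'m::finite" and \<delta> :: "'k \<Rightarrow> real"
  assumes fin: "finite K"
    and rat: "\<And>k i. k \<in> K \<Longrightarrow> vec_nth (\<alpha> k) i \<in> \<rat>"
    and feasible: "\<forall>k\<in>K. \<alpha> k \<bullet> x\<^sub>0 \<le> \<delta> k"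
  shows "\<exists>D::nat. 0 < D \<and> (\<forall>b \<mu>. (\<forall>i. vec_nth b i \<in> \<int>) \<longrightarrow>
    (\<forall>x. (\<forall>k\<in>K. \<alpha> k \<bullet> x \<le> \<delta> k) \<longrightarrow> b \<bullet> x \<le> \<mu>) \<longrightarrow>
    (\<exists>y::'k \<Rightarrow> nat. (\<Sum>k\<in>K. (real (y k) / real D) *\<^sub>R \<alpha> k) = b \<and>
       (\<Sum>k\<in>K. real (y k) / real D * \<delta> k) \<le> \<mu>))"
proof -
  define ind where "ind S \<longleftrightarrow> (\<forall>z. (\<Sum>k\<in>S. z k *\<^sub>R \<alpha> k) = 0 \<longrightarrow> (\<forall>k\<in>S. z k = 0))" for S
  \<comment> \<open>The conditions on \<open>S\<close> sit inside the existential, with 1 as witness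
    when they fail, so that choice yields a denominator function positive on every set.\<close>
  have "\<exists>D::nat. 0 < D \<and> (S \<subseteq> K \<and> ind S \<longrightarrow> (\<forall>y. (\<forall>i. vec_nth (\<Sum>k\<in>S. y k *\<^sub>R \<alpha> k) i \<in> \<int>) \<longrightarrow>
    (\<forall>k\<in>S. real D * y k \<in> \<int>)))" for S
  proof (cases "S \<subseteq> K \<and> ind S")
    case True
    then have S: "S \<subseteq> K" and "ind S" by simp_all
    have "\<forall>k\<in>S. z k = 0" if "(\<Sum>k\<in>S. z k *\<^sub>R \<alpha> k) = 0" for z
      using \<open>ind S\<close>[unfolded ind_def, rule_format, OF that] by simp
    from bounded_denominator_independent[of S \<alpha>, OF finite_subset[OF S fin] rat[OF subsetD[OF S]] this]
    obtain D :: nat where "0 < D" "\<forall>y. (\<forall>i. vec_nth (\<Sum>k\<in>S. y k *\<^sub>R \<alpha> k) i \<in> \<int>) \<longrightarrow>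
      (\<forall>k\<in>S. real D * y k \<in> \<int>)" by blast
    then show ?thesis by (intro exI[of _ D]) simp
  next
    case False
    then show ?thesis by (intro exI[of _ 1] conjI) (simp, blast)
  qed
  then obtain E :: "'k set \<Rightarrow> nat" where E: "\<And>S. 0 < E S"
    "\<And>S y. S \<subseteq> K \<Longrightarrow> ind S \<Longrightarrow> \<forall>i. vec_nth (\<Sum>k\<in>S. y k *\<^sub>R \<alpha> k) i \<in> \<int> \<Longrightarrow>
      \<forall>k\<in>S. real (E S) * y k \<in> \<int>"
    by metis
  \<comment> \<open>Every subset of \<open>K\<close> contributes a positive factor, so the
    denominator of whichever support arises divides \<open>D\<close>.\<close>
  define D where "D = prod E (Pow K)"
  have D: "0 < D" unfolding D_def using E(1) by (simp add: prod_pos)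
  show ?thesis
  proof (intro exI[of _ D] conjI D allI impI)
    fix b \<mu> assume int: "\<forall>i. vec_nth b i \<in> \<int>"
      and bound: "\<forall>x. (\<forall>k\<in>K. \<alpha> k \<bullet> x \<le> \<delta> k) \<longrightarrow> b \<bullet> x \<le> \<mu>"
    obtain y where y: "\<forall>k\<in>K. 0 \<le> y k" "(\<Sum>k\<in>K. y k *\<^sub>R \<alpha> k) = b" "(\<Sum>k\<in>K. y k * \<delta> k) \<le> \<mu>"
      "ind {k\<in>K. y k \<noteq> 0}"
      using lp_dual_basic[OF fin feasible, of b \<mu>] bound unfolding ind_def by blast
    define S where "S = {k\<in>K. y k \<noteq> 0}"
    have S: "S \<subseteq> K" "ind S" using y(4) by (auto simp: S_def)
    have "(\<Sum>k\<in>S. y k *\<^sub>R \<alpha> k) = b"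
      unfolding y(2)[symmetric] S_def using fin by (intro sum.mono_neutral_left) auto
    then have Sint: "\<forall>k\<in>S. real (E S) * y k \<in> \<int>" using E(2)[OF S] int by metis
    have "E S dvd D" unfolding D_def using S fin by (intro dvd_prodI) auto
    then obtain e where e: "D = E S * e" by (elim dvdE)
    have Dy: "real D * y k \<in> \<int>" if "k \<in> K" for k
    proof (cases "k \<in> S")
      case True
      have "real D * y k = real e * (real (E S) * y k)" by (simp add: e)
      then show ?thesis using Sint True by (metis Ints_mult Ints_of_nat)
    next
      case False
      then show ?thesis using that by (simp add: S_def)
    qed
    have nat: "real (nat \<lfloor>real D * y k\<rfloor>) / real D = y k" if "k \<in> K" for k
      using Dy[OF that] y(1) that D by (auto simp: field_simps elim!: Ints_cases)
    show "\<exists>y::'k \<Rightarrow> nat. (\<Sum>k\<in>K. (real (y k) / real D) *\<^sub>R \<alpha> k) = b \<and>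
       (\<Sum>k\<in>K. real (y k) / real D * \<delta> k) \<le> \<mu>"
      using y(2,3) nat by (intro exI[of _ "\<lambda>k. nat \<lfloor>real D * y k\<rfloor>"]) (simp cong: sum.cong)
  qed
qed

section \<open>Weak duality for semidefinite programs\<close>

text \<open>Eliminating an index \<open>p\<close> splits \<open>X\<close> into a rank-one matrix and
  a Schur complement living on the other indices. Paired with \<open>W\<close>, the former gives the
  quadratic form of \<open>W\<close> at row \<open>p\<close> of \<open>X\<close>, divided by
  \<open>X p p\<close>; the latter falls to the induction hypothesis.\<close>

lemma psd_inner_nonneg:
  fixes W X :: "'k \<Rightarrow> 'k \<Rightarrow> real"
  assumes "finite I"
    and "\<And>i j. i \<in> I \<Longrightarrow> j \<in> I \<Longrightarrow> X i j = X j i"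
    and "\<And>v. 0 \<le> (\<Sum>i\<in>I. \<Sum>j\<in>I. v i * X i j * v j)"
    and "\<And>v. 0 \<le> (\<Sum>i\<in>I. \<Sum>j\<in>I. v i * W i j * v j)"
  shows "0 \<le> (\<Sum>i\<in>I. \<Sum>j\<in>I. W i j * X i j)"
  using assms
proof (induction I arbitrary: X)
  case (insert p I)
  note fin = insert.hyps(1) and p = insert.hyps(2)
  have sym: "X i p = X p i" if "i \<in> I" for i using insert.prems(1) that by blast
  have Q: "(\<Sum>i\<in>insert p I. \<Sum>j\<in>insert p I. v i * X i j * v j) =
      X p p * (v p)\<^sup>2 + 2 * v p * (\<Sum>j\<in>I. X p j * v j) + (\<Sum>i\<in>I. \<Sum>j\<in>I. v i * X i j * v j)" for v
    using fin p sym by (simp add: sum.distrib sum_distrib_left algebra_simps power2_eq_square)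
  have pp: "0 \<le> X p p"
  proof -
    have eq: "(i = p) = False" if "i \<in> I" for i using that p by auto
    show ?thesis
      using insert.prems(2)[of "(\<lambda>_. 0)(p := 1)"] unfolding Q by (simp add: eq cong: sum.cong)
  qed
  have zero: "X p j = 0" if "X p p = 0" "j \<in> I" for j
  proof (rule ccontr)
    assume nz: "X p j \<noteq> 0"
    \<comment> \<open>Chosen so that the form takes the value -1 at the vector with entry 1 at
      \<open>j\<close> and \<open>s\<close> at \<open>p\<close>.\<close>
    define s where "s = - (X j j + 1) / (2 * X p j)"
    have "j \<noteq> p" using that p by auto
    have "0 \<le> (\<Sum>i\<in>insert p I. \<Sum>k\<in>insert p I. ((\<lambda>_. 0)(j := 1, p := s)) i * X i k * ((\<lambda>_. 0)(j := 1, p := s)) k)"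
      by (rule insert.prems(2))
    also have "\<dots> = 2 * s * X p j + X j j"
    proof -
      have eq: "(i = p) = False" if "i \<in> I" for i using that p by auto
      show ?thesis
        unfolding Q using that fin \<open>j \<noteq> p\<close>
        by (simp add: eq if_distrib[of "\<lambda>c. c * _"] if_distrib[of "\<lambda>c. _ * c"] cong: if_cong sum.cong)
    qed
    also have "\<dots> = -1" using nz by (simp add: s_def field_simps)
    finally show False by simp
  qed
  \<comment> \<open>The Schur complement at \<open>p\<close>. For \<open>X p p = 0\<close> the quotient is the junk value 0, which
    is harmless because then row \<open>p\<close> vanishes.\<close>
  define S where "S i j = X i j - X p i * X p j / X p p" for i j
  have Sp: "S p j = 0" if "j \<in> insert p I" for j
    using zero that by (cases "X p p = 0") (auto simp: S_def)
  have Sp': "S i p = 0" if "i \<in> insert p I" for i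
    using Sp[OF that] sym that by (auto simp: S_def mult.commute)
  have "0 \<le> (\<Sum>i\<in>I. \<Sum>j\<in>I. W i j * S i j)"
  proof (rule insert.IH)
    show "S i j = S j i" if "i \<in> I" "j \<in> I" for i j
      using insert.prems(1) that by (simp add: S_def mult.commute)
  next
    fix v
    define r where "r = (\<Sum>j\<in>I. X p j * v j)"
    have "(\<Sum>i\<in>I. \<Sum>j\<in>I. v i * S i j * v j) =
        (\<Sum>i\<in>I. \<Sum>j\<in>I. v i * X i j * v j) - (\<Sum>i\<in>I. \<Sum>j\<in>I. (X p i * v i) * (X p j * v j)) / X p p"
      by (simp add: S_def algebra_simps sum_subtractf sum_divide_distrib)
    also have "(\<Sum>i\<in>I. \<Sum>j\<in>I. (X p i * v i) * (X p j * v j)) = r\<^sup>2"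
      by (simp add: r_def power2_eq_square sum_product)
    finally have S: "(\<Sum>i\<in>I. \<Sum>j\<in>I. v i * S i j * v j) = (\<Sum>i\<in>I. \<Sum>j\<in>I. v i * X i j * v j) - r\<^sup>2 / X p p" .
    have eq: "(i = p) = False" if "i \<in> I" for i using that p by auto
    \<comment> \<open>For positive \<open>X p p\<close>, the entry \<open>- r / X p p\<close> at
      \<open>p\<close> minimises the form over that coordinate, and the minimum is the form of the
      Schur complement. For \<open>X p p = 0\<close> the quotients are 0 and both sides are the form
      of \<open>X\<close> on \<open>I\<close>.\<close>
    have "0 \<le> X p p * (r / X p p)\<^sup>2 - 2 * (r / X p p) * r + (\<Sum>i\<in>I. \<Sum>j\<in>I. v i * X i j * v j)"
      using insert.prems(2)[of "v(p := - r / X p p)"] unfolding Q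
      by (simp add: eq r_def cong: sum.cong)
    also have "\<dots> = (\<Sum>i\<in>I. \<Sum>j\<in>I. v i * S i j * v j)"
      unfolding S by (cases "X p p = 0") (simp_all add: power2_eq_square field_simps)
    finally show "0 \<le> (\<Sum>i\<in>I. \<Sum>j\<in>I. v i * S i j * v j)" .
  next
    fix v
    have eq: "(i = p) = False" if "i \<in> I" for i using that p by auto
    show "0 \<le> (\<Sum>i\<in>I. \<Sum>j\<in>I. v i * W i j * v j)"
      using insert.prems(3)[of "v(p := 0)"] fin p by (simp add: eq cong: sum.cong)
  qed
  also have "\<dots> = (\<Sum>i\<in>insert p I. \<Sum>j\<in>insert p I. W i j * S i j)"
    using fin p Sp Sp' by simp
  finally have 1: "0 \<le> (\<Sum>i\<in>insert p I. \<Sum>j\<in>insert p I. W i j * S i j)" .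
  have "0 \<le> (\<Sum>i\<in>insert p I. \<Sum>j\<in>insert p I. X p i * W i j * X p j) / X p p"
    using insert.prems(3)[of "X p"] pp by simp
  also have "\<dots> = (\<Sum>i\<in>insert p I. \<Sum>j\<in>insert p I. W i j * (X p i * X p j / X p p))"
    unfolding sum_divide_distrib by (simp add: mult_ac)
  finally have "0 \<le> \<dots> + (\<Sum>i\<in>insert p I. \<Sum>j\<in>insert p I. W i j * S i j)"
    using 1 by (rule add_nonneg_nonneg)
  also have "\<dots> = (\<Sum>i\<in>insert p I. \<Sum>j\<in>insert p I. W i j * X i j)"
    by (simp only: sum.distrib[symmetric] S_def) (simp add: algebra_simps)
  finally show ?case .
qed simp

text \<open>Test vectors become plain functions, which can be built by update and conditionals and
  which match the shape of \<open>psd_inner_nonneg\<close>.\<close>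

lemma psd_iff_sum:
  "psd n A \<longleftrightarrow> A \<in> carrier_mat n n \<and> transpose_mat A = A \<and>
    (\<forall>v. 0 \<le> (\<Sum>i<n. \<Sum>j<n. v i * A $$ (i, j) * v j))"
proof -
  have *: "scalar_prod v (A *\<^sub>v v) = (\<Sum>i<n. \<Sum>j<n. vec_index v i * A $$ (i, j) * vec_index v j)"
    if "A \<in> carrier_mat n n" "v \<in> carrier_vec n" for v
    using that by (simp add: scalar_prod_def sum_distrib_left mult.assoc atLeast0LessThan)
  have "(\<forall>v\<in>carrier_vec n. 0 \<le> scalar_prod v (A *\<^sub>v v)) \<longleftrightarrow>
      (\<forall>v. 0 \<le> (\<Sum>i<n. \<Sum>j<n. v i * A $$ (i, j) * v j))" if A: "A \<in> carrier_mat n n"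
  proof (intro iffI allI ballI)
    fix v :: "nat \<Rightarrow> real"
    assume "\<forall>v\<in>carrier_vec n. 0 \<le> scalar_prod v (A *\<^sub>v v)"
    then have "0 \<le> scalar_prod (vec n v) (A *\<^sub>v vec n v)" by simp
    then show "0 \<le> (\<Sum>i<n. \<Sum>j<n. v i * A $$ (i, j) * v j)"
      by (subst (asm) *[OF A]) auto
  qed (simp add: *[OF A])
  then show ?thesis unfolding psd_def symmetric_of_order_def by blast
qed

lemma mat_inner_eq_sum:
  assumes "A \<in> carrier_mat n n" "X \<in> carrier_mat n n"
  shows "mat_inner A X = (\<Sum>i<n. \<Sum>j<n. A $$ (i, j) * X $$ (i, j))"
proof -
  have "mat_inner A X = (\<Sum>i<n. \<Sum>j<n. A $$ (j, i) * X $$ (j, i))"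
    using assms by (simp add: mat_inner_def scalar_prod_def atLeast0LessThan)
  then show ?thesis by (subst sum.swap)
qed

lemma pencil_carrier [simp]: "C \<in> carrier_mat n n \<Longrightarrow> pencil C A x \<in> carrier_mat n n"
  by (rule carrier_matI) (simp_all add: pencil_def)

text \<open>The duality gap is the inner product of the pencil at \<open>x\<close> with
  \<open>X\<close>, and both are positive semidefinite.\<close>

lemma sdp_weak_duality:
  fixes A :: "'m::finite \<Rightarrow> real mat"
  assumes C: "C \<in> carrier_mat n n" and A: "\<And>i. A i \<in> carrier_mat n n"
    and x: "x \<in> spectrahedron n C A" and X: "dual_feasible n A b X"
  shows "inner b x \<le> mat_inner C X"
proof -
  have psdX: "psd n X" and b: "\<And>i. vec_nth b i = mat_inner (A i) X"
    using X by (auto simp: dual_feasible_def)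
  then have Xc: "X \<in> carrier_mat n n" by (simp add: psd_iff_sum)
  have sym: "X $$ (i, j) = X $$ (j, i)" if "i < n" "j < n" for i j
    using psdX that by (metis psd_iff_sum carrier_matD index_transpose_mat(1))
  have "0 \<le> (\<Sum>i<n. \<Sum>j<n. pencil C A x $$ (i, j) * X $$ (i, j))"
  proof (rule psd_inner_nonneg[OF finite_lessThan])
    show "0 \<le> (\<Sum>i<n. \<Sum>j<n. v i * X $$ (i, j) * v j)" for v
      using psdX unfolding psd_iff_sum by blast
    show "0 \<le> (\<Sum>i<n. \<Sum>j<n. v i * pencil C A x $$ (i, j) * v j)" for v
      using x unfolding psd_iff_sum spectrahedron_def by blast
    show "X $$ (i, j) = X $$ (j, i)" if "i \<in> {..<n}" "j \<in> {..<n}" for i j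
      using that by (intro sym) simp_all
  qed
  also have "\<dots> = (\<Sum>i<n. \<Sum>j<n. C $$ (i, j) * X $$ (i, j) -
      (\<Sum>k\<in>UNIV. vec_nth x k * (A k $$ (i, j) * X $$ (i, j))))"
    using C by (intro sum.cong refl) (simp add: pencil_def algebra_simps sum_distrib_left)
  also have "\<dots> = mat_inner C X - (\<Sum>i<n. \<Sum>j<n. \<Sum>k\<in>UNIV. vec_nth x k * (A k $$ (i, j) * X $$ (i, j)))"
    by (simp add: sum_subtractf mat_inner_eq_sum[OF C Xc])
  also have "(\<Sum>i<n. \<Sum>j<n. \<Sum>k\<in>UNIV. vec_nth x k * (A k $$ (i, j) * X $$ (i, j))) =
      (\<Sum>i<n. \<Sum>k\<in>UNIV. \<Sum>j<n. vec_nth x k * (A k $$ (i, j) * X $$ (i, j)))"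
    by (rule sum.cong[OF refl], rule sum.swap)
  also have "\<dots> = (\<Sum>k\<in>UNIV. \<Sum>i<n. \<Sum>j<n. vec_nth x k * (A k $$ (i, j) * X $$ (i, j)))"
    by (rule sum.swap)
  also have "\<dots> = inner b x"
    by (simp add: inner_vec_def b mat_inner_eq_sum[OF A Xc] mult.commute[of _ "vec_nth x _"] flip: sum_distrib_left)
  finally show ?thesis by simp
qed

section \<open>Appending a diagonal block\<close>

text \<open>On pencils this adjoins scalar inequalities to a linear matrix inequality; the same
  shape with \<open>U\<close> zero gives the dual matrices supported on the new rows.\<close>

definition append_diag :: "real mat \<Rightarrow> real vec \<Rightarrow> real mat" where
  "append_diag U g = four_block_mat U (0\<^sub>m (dim_row U) (dim_vec g)) (0\<^sub>m (dim_vec g) (dim_col U)) (Diag g)"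

lemma append_diag_carrier [simp]:
  "U \<in> carrier_mat n n \<Longrightarrow> g \<in> carrier_vec l \<Longrightarrow> append_diag U g \<in> carrier_mat (n + l) (n + l)"
  by (auto simp: append_diag_def Diag_def mat_diag_def)

lemma append_diag_index:
  assumes "U \<in> carrier_mat n n" "g \<in> carrier_vec l" "i < n + l" "j < n + l"
  shows "append_diag U g $$ (i, j) =
    (if i < n \<and> j < n then U $$ (i, j) else if i = j then vec_index g (i - n) else 0)"
  using assms by (auto simp: append_diag_def Diag_def mat_diag_def)

lemma transpose_append_diag:
  assumes U: "U \<in> carrier_mat n n" and g: "g \<in> carrier_vec l"
  shows "transpose_mat (append_diag U g) = append_diag (transpose_mat U) g"
proof -
  have U': "transpose_mat U \<in> carrier_mat n n" using U by simp
  show ?thesis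
  proof (rule eq_matI)
    fix i j assume "i < dim_row (append_diag (transpose_mat U) g)" "j < dim_col (append_diag (transpose_mat U) g)"
    then have "i < n + l" "j < n + l" using append_diag_carrier[OF U' g] by auto
    then show "transpose_mat (append_diag U g) $$ (i, j) = append_diag (transpose_mat U) g $$ (i, j)"
      using append_diag_carrier[OF U g] U
      by (auto simp: append_diag_index[OF U g] append_diag_index[OF U' g])
  qed (use append_diag_carrier[OF U g] append_diag_carrier[OF U' g] in auto)
qed

text \<open>With \<open>f i j = v i * v j\<close> this computes quadratic forms, and with
  \<open>f\<close> the entries of a matrix it computes inner products.\<close>

lemma sum_append_diag:
  assumes "U \<in> carrier_mat n n" "g \<in> carrier_vec l"
  shows "(\<Sum>i<n+l. \<Sum>j<n+l. append_diag U g $$ (i, j) * f i j) =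
    (\<Sum>i<n. \<Sum>j<n. U $$ (i, j) * f i j) + (\<Sum>k<l. vec_index g k * f (n + k) (n + k))"
proof -
  have split: "(\<Sum>i<n+l. h i) = (\<Sum>i<n. h i) + (\<Sum>k<l. h (n + k))" for h :: "nat \<Rightarrow> real"
    by (induction l) auto
  have "(\<Sum>j<n+l. append_diag U g $$ (i, j) * f i j) = (\<Sum>j<n. U $$ (i, j) * f i j)" if "i < n" for i
    using that by (simp add: split append_diag_index[OF assms])
  moreover have "(\<Sum>j<n+l. append_diag U g $$ (n + k, j) * f (n + k) j) = vec_index g k * f (n + k) (n + k)"
    if "k < l" for k
    using that by (simp add: split append_diag_index[OF assms] if_distrib[of "\<lambda>c. c * _"] cong: if_cong)
  ultimately show ?thesis by (simp add: split)
qed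

lemma psd_append_diag:
  assumes U: "U \<in> carrier_mat n n" and g: "g \<in> carrier_vec l"
  shows "psd (n + l) (append_diag U g) \<longleftrightarrow> psd n U \<and> (\<forall>k<l. 0 \<le> vec_index g k)"
proof -
  have form: "(\<Sum>i<n+l. \<Sum>j<n+l. v i * append_diag U g $$ (i, j) * v j) =
      (\<Sum>i<n. \<Sum>j<n. v i * U $$ (i, j) * v j) + (\<Sum>k<l. vec_index g k * (v (n + k))\<^sup>2)" for v
    using sum_append_diag[OF U g, of "\<lambda>i j. v i * v j"] by (simp add: mult_ac power2_eq_square)
  have trans: "transpose_mat (append_diag U g) = append_diag U g \<longleftrightarrow> transpose_mat U = U"
  proof
    assume tr: "transpose_mat (append_diag U g) = append_diag U g"
    show "transpose_mat U = U"
    proof (rule eq_matI)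
      fix i j assume "i < dim_row U" "j < dim_col U"
      then have ij: "i < n" "j < n" using U by auto
      have "append_diag U g $$ (j, i) = append_diag U g $$ (i, j)"
        using tr ij append_diag_carrier[OF U g]
        by (metis carrier_matD index_transpose_mat(1) trans_less_add1)
      then show "transpose_mat U $$ (i, j) = U $$ (i, j)"
        using ij U by (simp add: append_diag_index[OF U g])
    qed (use U in auto)
  next
    assume "transpose_mat U = U"
    then show "transpose_mat (append_diag U g) = append_diag U g"
      by (simp add: transpose_append_diag[OF U g])
  qed
  show ?thesis
  proof (intro iffI conjI allI impI)
    assume psd: "psd (n + l) (append_diag U g)"
    then have nonneg: "0 \<le> (\<Sum>i<n. \<Sum>j<n. v i * U $$ (i, j) * v j) + (\<Sum>k<l. vec_index g k * (v (n + k))\<^sup>2)" for v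
      by (simp add: psd_iff_sum form)
    show "psd n U"
      unfolding psd_iff_sum
    proof (intro conjI allI)
      fix v :: "nat \<Rightarrow> real"
      show "0 \<le> (\<Sum>i<n. \<Sum>j<n. v i * U $$ (i, j) * v j)"
        using nonneg[of "\<lambda>i. if i < n then v i else 0"] by simp
    qed (use U psd trans in \<open>auto simp: psd_iff_sum\<close>)
    fix k assume "k < l"
    then show "0 \<le> vec_index g k"
      using nonneg[of "\<lambda>i. if i = n + k then 1 else 0"]
      by (simp add: if_distrib[of "\<lambda>c. _ * c"] if_distrib[of "\<lambda>c. c\<^sup>2"] cong: if_cong)
  next
    assume "psd n U \<and> (\<forall>k<l. 0 \<le> vec_index g k)"
    then show "psd (n + l) (append_diag U g)"
      using trans append_diag_carrier[OF U g]
      unfolding psd_iff_sum form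
      by (intro conjI allI add_nonneg_nonneg) (auto intro!: sum_nonneg[of "{..<l}"])
  qed
qed

lemma pencil_append_diag:
  fixes A :: "'m::finite \<Rightarrow> real mat"
  assumes C: "C \<in> carrier_mat n n" and A: "\<And>i. A i \<in> carrier_mat n n"
    and g: "g \<in> carrier_vec l" and h: "\<And>i. h i \<in> carrier_vec l"
  shows "pencil (append_diag C g) (\<lambda>i. append_diag (A i) (h i)) x =
    append_diag (pencil C A x) (vec l (\<lambda>k. vec_index g k - (\<Sum>i\<in>UNIV. vec_index (h i) k * vec_nth x i)))"
    (is "_ = append_diag _ ?g")
proof -
  have P: "pencil C A x \<in> carrier_mat n n" using C by (rule pencil_carrier)
  show ?thesis
  proof (rule eq_matI)
    fix i j assume "i < dim_row (append_diag (pencil C A x) ?g)" "j < dim_col (append_diag (pencil C A x) ?g)"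
    then have ij: "i < n + l" "j < n + l" using append_diag_carrier[OF P, of ?g l] by auto
    have "pencil (append_diag C g) (\<lambda>i. append_diag (A i) (h i)) x $$ (i, j) =
        append_diag C g $$ (i, j) - (\<Sum>k\<in>UNIV. append_diag (A k) (h k) $$ (i, j) * vec_nth x k)"
      using append_diag_carrier[OF C g] ij by (simp add: pencil_def)
    moreover have "pencil C A x $$ (i, j) = C $$ (i, j) - (\<Sum>k\<in>UNIV. A k $$ (i, j) * vec_nth x k)"
      if "i < n" "j < n"
      using C that by (simp add: pencil_def)
    ultimately show "pencil (append_diag C g) (\<lambda>i. append_diag (A i) (h i)) x $$ (i, j) =
        append_diag (pencil C A x) ?g $$ (i, j)"
      using ij by (auto simp: append_diag_index[OF C g] append_diag_index[OF A h] append_diag_index[OF P, where l = l])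
  next
    have 1: "append_diag (pencil C A x) ?g \<in> carrier_mat (n + l) (n + l)" using P by simp
    have 2: "pencil (append_diag C g) (\<lambda>i. append_diag (A i) (h i)) x \<in> carrier_mat (n + l) (n + l)"
      using C g by simp
    show "dim_row (pencil (append_diag C g) (\<lambda>i. append_diag (A i) (h i)) x) =
        dim_row (append_diag (pencil C A x) ?g)"
      "dim_col (pencil (append_diag C g) (\<lambda>i. append_diag (A i) (h i)) x) =
        dim_col (append_diag (pencil C A x) ?g)" 
      by (simp_all only: carrier_matD[OF 1] carrier_matD[OF 2])
  qed
qed

lemma pencil_Diag:
  fixes a :: "'m::finite \<Rightarrow> real vec"
  assumes d: "d \<in> carrier_vec l" and a: "\<And>i. a i \<in> carrier_vec l"
  shows "pencil (Diag d) (\<lambda>i. Diag (a i)) x =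
    Diag (vec l (\<lambda>k. vec_index d k - (\<Sum>i\<in>UNIV. vec_index (a i) k * vec_nth x i)))"
proof -
  have "dim_vec (a i) = l" for i using a carrier_vecD by blast
  then show ?thesis using d by (intro eq_matI) (auto simp: pencil_def Diag_def mat_diag_def)
qed

lemma psd_Diag: "psd (dim_vec g) (Diag g) \<longleftrightarrow> (\<forall>k<dim_vec g. 0 \<le> vec_index g k)"
proof -
  have "append_diag (0\<^sub>m 0 0) g = Diag g"
    by (rule eq_matI) (auto simp: append_diag_def Diag_def mat_diag_def)
  then show ?thesis
    using psd_append_diag[of "0\<^sub>m 0 0" 0 g "dim_vec g"]
    by (auto simp: psd_iff_sum)
qed

section \<open>From the normal form to the extended inequality\<close>

text \<open>The entry is the quadratic form of \<open>W\<close> at row \<open>r\<close> of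
  \<open>M\<close>. Applied to the lower-right block of the normal form, it shows that P satisfies
  the rows of Q.\<close>

lemma diagonal_congruence_nonneg:
  assumes W: "psd n W" and M: "M \<in> carrier_mat n n" and r: "r < n"
  shows "0 \<le> (M * W * transpose_mat M) $$ (r, r)"
proof -
  have Wc: "W \<in> carrier_mat n n" using W by (simp add: psd_iff_sum)
  have "(M * W * transpose_mat M) $$ (r, r) = (M * (W * transpose_mat M)) $$ (r, r)"
    using M Wc by (simp add: assoc_mult_mat[of _ n n _ n _ n])
  also have "\<dots> = scalar_prod (row M r) (col (W * transpose_mat M) r)"
    using M Wc r by simp
  also have "col (W * transpose_mat M) r = W *\<^sub>v row M r"
    using M Wc r by (simp add: col_mult2[of _ n n _ n])
  finally show ?thesis
    using W row_carrier_vec[OF r M] by (simp add: psd_def)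
qed

theorem theorem8:
  fixes C :: "real mat" and A :: "'m::finite \<Rightarrow> real mat"
    and M C' :: "real mat" and A' :: "'m \<Rightarrow> real mat"
    and d :: "real vec" and a :: "'m \<Rightarrow> real vec"
    and n l :: nat
    and P Z :: "(real^'m) set"
  assumes "symmetric_of_order n C" and "\<And>i. symmetric_of_order n (A i)"
    and "P = spectrahedron n C A"
    and "aff_dim P = int CARD('m)"
    and "normal_form n C A M l C' A' d a"
    and "\<And>b i. b \<in> Z \<Longrightarrow> vec_nth b i \<in> \<int>"
    and "\<And>b. b \<in> Z \<Longrightarrow>
      max_value b P = max_value b (spectrahedron l (Diag d) (\<lambda>i. Diag (a i)))"
  shows "\<exists>N (C\<^sub>0 :: real mat) (A\<^sub>0 :: 'm \<Rightarrow> real mat).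
    N \<ge> 1 \<and> symmetric_of_order N C\<^sub>0 \<and> (\<forall>i. symmetric_of_order N (A\<^sub>0 i)) \<and>
    spectrahedron N C\<^sub>0 A\<^sub>0 = P \<and> TDI_on N C\<^sub>0 A\<^sub>0 Z"
proof -
  have M: "M \<in> carrier_mat n n" and l: "1 \<le> l" "l \<le> n"
    and C': "C' \<in> carrier_mat (n - l) (n - l)"
    and d: "d \<in> carrier_vec l" and a: "\<And>i. a i \<in> carrier_vec l"
    and block: "\<And>x. M * pencil C A x * transpose_mat M =
        four_block_mat (pencil C' A' x) (0\<^sub>m (n - l) l)
                       (0\<^sub>m l (n - l)) (pencil (Diag d) (\<lambda>i. Diag (a i)) x)"
    using assms(5) by (auto simp: normal_form_def block_diagonalizes_def symmetric_of_order_def)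
  have al: "dim_vec (a i) = l" for i using a carrier_vecD by blast
  then have rat: "\<And>i k. k < l \<Longrightarrow> vec_index (a i) k \<in> \<rat>"
    using assms(5) by (simp add: normal_form_def rational_vec_def)
  have C: "C \<in> carrier_mat n n" and A: "\<And>i. A i \<in> carrier_mat n n"
    using assms(1,2) by (auto simp: symmetric_of_order_def)
  have pencil: "pencil C A x \<in> carrier_mat n n" for x
    using C by (rule pencil_carrier)
  \<comment> \<open>The vectors \<open>a i\<close> are columns of the linear system of Q; its rows
    are needed here.\<close>
  define \<alpha> :: "nat \<Rightarrow> real^'m" where "\<alpha> k = vec_lambda (\<lambda>i. vec_index (a i) k)" for k
  have \<alpha>: "inner (\<alpha> k) x = (\<Sum>i\<in>UNIV. vec_index (a i) k * vec_nth x i)" for k x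
    by (simp add: \<alpha>_def inner_vec_def)
  let ?slack = "\<lambda>x. vec l (\<lambda>k. vec_index d k - (\<Sum>i\<in>UNIV. vec_index (a i) k * vec_nth x i))"
  have polyhedron: "x \<in> spectrahedron l (Diag d) (\<lambda>i. Diag (a i)) \<longleftrightarrow>
      (\<forall>k\<in>{..<l}. inner (\<alpha> k) x \<le> vec_index d k)" for x
    using psd_Diag[of "?slack x"] by (auto simp: spectrahedron_def pencil_Diag[OF d a] \<alpha>)
  have P_le: "inner (\<alpha> k) x \<le> vec_index d k" if x: "x \<in> P" and k: "k < l" for x k
  proof -
    have "n - l + k < n" using k l by simp
    then have "0 \<le> (M * pencil C A x * transpose_mat M) $$ (n - l + k, n - l + k)"
      using x assms(3) by (intro diagonal_congruence_nonneg[OF _ M]) (auto simp: spectrahedron_def)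
    also have "\<dots> = Diag (?slack x) $$ (k, k)"
      unfolding block pencil_Diag[OF d a]
      using k C' by (simp add: pencil_def Diag_def mat_diag_def)
    also have "\<dots> = vec_index d k - inner (\<alpha> k) x"
      using k by (simp add: Diag_def mat_diag_def \<alpha>)
    finally show ?thesis by simp
  qed
  \<comment> \<open>The empty set has affine dimension -1, so full dimension supplies the feasible
    point for LP duality.\<close>
  have "P \<noteq> {}" using assms(4) by auto
  then obtain x\<^sub>0 where "x\<^sub>0 \<in> P" by blast
  with P_le have feasible: "\<forall>k\<in>{..<l}. inner (\<alpha> k) x\<^sub>0 \<le> vec_index d k" by blast
  have "\<And>k i. k \<in> {..<l} \<Longrightarrow> vec_nth (\<alpha> k) i \<in> \<rat>" using rat by (simp add: \<alpha>_def)
  from lp_dual_bounded_denominator[OF finite_lessThan this feasible]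
  obtain D :: nat where D: "0 < D" and dual: "\<And>b \<mu>. \<forall>i. vec_nth b i \<in> \<int> \<Longrightarrow>
      \<forall>x. (\<forall>k\<in>{..<l}. inner (\<alpha> k) x \<le> vec_index d k) \<longrightarrow> inner b x \<le> \<mu> \<Longrightarrow>
      \<exists>y::nat \<Rightarrow> nat. (\<Sum>k<l. (real (y k) / real D) *\<^sub>R \<alpha> k) = b \<and>
        (\<Sum>k<l. real (y k) / real D * vec_index d k) \<le> \<mu>"
    by blast
  define g where "g = (1 / real D) \<cdot>\<^sub>v d"
  define h where "h i = (1 / real D) \<cdot>\<^sub>v a i" for i
  have g: "g \<in> carrier_vec l" and h: "\<And>i. h i \<in> carrier_vec l"
    using d a by (auto simp: g_def h_def)
  define C\<^sub>0 where "C\<^sub>0 = append_diag C g"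
  define A\<^sub>0 where "A\<^sub>0 i = append_diag (A i) (h i)" for i
  have C0: "C\<^sub>0 \<in> carrier_mat (n + l) (n + l)" and A0: "\<And>i. A\<^sub>0 i \<in> carrier_mat (n + l) (n + l)"
    using C A g h by (auto simp: C\<^sub>0_def A\<^sub>0_def)
  have spectrahedron: "spectrahedron (n + l) C\<^sub>0 A\<^sub>0 = P"
  proof -
    have "psd (n + l) (pencil C\<^sub>0 A\<^sub>0 x) \<longleftrightarrow> psd n (pencil C A x) \<and> (\<forall>k<l. inner (\<alpha> k) x \<le> vec_index d k)" for x
    proof -
      have "vec_index g k - (\<Sum>i\<in>UNIV. vec_index (h i) k * vec_nth x i) =
          (vec_index d k - inner (\<alpha> k) x) / real D" if "k < l" for k
        using that d al by (simp add: g_def h_def \<alpha> diff_divide_distrib sum_divide_distrib)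
      then show ?thesis
        unfolding C\<^sub>0_def A\<^sub>0_def pencil_append_diag[OF C A g h]
        using D by (subst psd_append_diag[OF pencil]) (auto simp: zero_le_divide_iff)
    qed
    then show ?thesis
      using P_le assms(3) by (auto simp: spectrahedron_def)
  qed
  have TDI: "TDI_on (n + l) C\<^sub>0 A\<^sub>0 Z"
  proof -
    \<comment> \<open>The diagonal matrix units of the appended block form the finite generating
      set, the same for all \<open>b\<close>.\<close>
    define E where "E k = append_diag (0\<^sub>m n n) (unit_vec l k)" for k
    have E_index: "E k $$ (i, j) = (if i = n + k \<and> j = n + k then 1 else 0)"
      if "k < l" "i < n + l" "j < n + l" for i j k
      using that by (auto simp: E_def append_diag_index[where n = n and l = l])
    \<comment> \<open>In \<open>PZ\<close> the coefficients are indexed by matrices, so the index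
      \<open>k\<close> has to be recoverable from \<open>E k\<close>.\<close>
    have inj: "inj_on E {..<l}"
    proof (rule inj_onI)
      fix j k assume *: "j \<in> {..<l}" "k \<in> {..<l}" "E j = E k"
      then have "E k $$ (n + j, n + j) = 1" using E_index[of j "n + j" "n + j"] by simp
      then show "j = k" using * E_index[of k "n + j" "n + j"] by (auto split: if_splits)
    qed
    have zero: "psd n (0\<^sub>m n n)" by (simp add: psd_iff_sum)
    have psd_E: "psd (n + l) (E k)" if "k < l" for k
      unfolding E_def using zero by (subst psd_append_diag) (auto simp: unit_vec_def)
    have int_E: "integer_mat (E k)" if "k < l" for k
    proof -
      have "E k \<in> carrier_mat (n + l) (n + l)" unfolding E_def by (intro append_diag_carrier) auto
      then show ?thesis
        unfolding integer_mat_def using E_index[OF that] by (simp add: carrier_matD)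
    qed
    have "\<exists>X. dual_optimal (n + l) C\<^sub>0 A\<^sub>0 b X \<and> PZ (n + l) (E ` {..<l}) X"
      if b: "b \<in> Z" and X: "dual_optimal (n + l) C\<^sub>0 A\<^sub>0 b X" for b X
    proof -
      \<comment> \<open>The cost of \<open>X\<close> is a finite bound, so the extended-real
        equality of the two suprema also rules out an objective unbounded over Q.\<close>
      have "max_value b P \<le> ereal (mat_inner C\<^sub>0 X)"
        unfolding max_value_def using X spectrahedron sdp_weak_duality[OF C0 A0]
        by (auto simp: dual_optimal_def intro!: SUP_least)
      then have le: "max_value b (spectrahedron l (Diag d) (\<lambda>i. Diag (a i))) \<le> ereal (mat_inner C\<^sub>0 X)"
        using assms(7)[OF b] by simp
      have "inner b x \<le> mat_inner C\<^sub>0 X" if "\<forall>k\<in>{..<l}. inner (\<alpha> k) x \<le> vec_index d k" for x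
        using le that polyhedron unfolding max_value_def SUP_le_iff by fastforce
      then obtain y :: "nat \<Rightarrow> nat" where y: "(\<Sum>k<l. (real (y k) / real D) *\<^sub>R \<alpha> k) = b"
        "(\<Sum>k<l. real (y k) / real D * vec_index d k) \<le> mat_inner C\<^sub>0 X"
        using dual[of b "mat_inner C\<^sub>0 X"] assms(6)[OF b] by blast
      \<comment> \<open>The block facing the original matrices is zero, so inner products with
        \<open>Y\<close> see the appended rows alone. These are divided by \<open>D\<close>, hence
        the weights \<open>y k\<close> in place of \<open>y k / D\<close>.\<close>
      define Y where "Y = append_diag (0\<^sub>m n n) (vec l (\<lambda>k. real (y k)))"
      have Yc: "Y \<in> carrier_mat (n + l) (n + l)" unfolding Y_def by (intro append_diag_carrier) auto
      have psd_Y: "psd (n + l) Y"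
        unfolding Y_def using zero by (subst psd_append_diag) auto
      have inner_Y: "mat_inner (append_diag U u) Y = (\<Sum>k<l. vec_index u k * real (y k))"
        if U: "U \<in> carrier_mat n n" and u: "u \<in> carrier_vec l" for U u
        using sum_append_diag[OF U u, of "\<lambda>i j. Y $$ (i, j)"]
        by (simp add: mat_inner_eq_sum[OF append_diag_carrier[OF U u] Yc])
          (simp add: Y_def append_diag_index[where n = n and l = l])
      have "mat_inner (A\<^sub>0 i) Y = vec_nth b i" for i
        unfolding A\<^sub>0_def inner_Y[OF A h] y(1)[symmetric]
        using al by (simp add: h_def \<alpha>_def mult.commute)
      then have feas: "dual_feasible (n + l) A\<^sub>0 b Y"
        using psd_Y by (simp add: dual_feasible_def)
      have "mat_inner C\<^sub>0 Y \<le> mat_inner C\<^sub>0 X"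
        unfolding C\<^sub>0_def inner_Y[OF C g] using y(2) d by (simp add: g_def C\<^sub>0_def mult.commute)
      with feas X have "dual_optimal (n + l) C\<^sub>0 A\<^sub>0 b Y"
        unfolding dual_optimal_def by force
      moreover have "PZ (n + l) (E ` {..<l}) Y"
        unfolding PZ_def
      proof (intro conjI psd_Y exI[of _ "y \<circ> inv_into {..<l} E"])
        have "(\<Sum>V\<in>E ` {..<l}. real ((y \<circ> inv_into {..<l} E) V) * V $$ (r, s)) =
            (\<Sum>k<l. real (y k) * E k $$ (r, s))" for r s
          by (simp add: sum.reindex[OF inj] inv_into_f_f[OF inj])
        moreover have "Y $$ (r, s) = (\<Sum>k<l. real (y k) * E k $$ (r, s))"
          if rs: "r < n + l" "s < n + l" for r s
        proof -
          \<comment> \<open>Subtraction is truncated: for \<open>r < n\<close> the index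
            \<open>r - n\<close> is 0, and the inner guard \<open>n \<le> r\<close> keeps that term
            from contributing.\<close>
          have "(\<Sum>k<l. real (y k) * E k $$ (r, s)) =
              (\<Sum>k<l. if k = r - n then (if r = s \<and> n \<le> r then real (y k) else 0) else 0)"
            using rs by (intro sum.cong) (auto simp: E_index)
          also have "\<dots> = Y $$ (r, s)"
            using rs l by (auto simp: Y_def append_diag_index[where n = n and l = l])
          finally show ?thesis by simp
        qed
        ultimately show "Y = mat (n + l) (n + l) (\<lambda>(r, s). \<Sum>V\<in>E ` {..<l}.
            real ((y \<circ> inv_into {..<l} E) V) * V $$ (r, s))"
          using Yc by (intro eq_matI) auto
      qed
      ultimately show ?thesis by blast
    qed
    then show ?thesis
      unfolding TDI_on_def using psd_E int_E by (intro exI[of _ "E ` {..<l}"]) auto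
  qed
  have sym: "symmetric_of_order (n + l) (append_diag U u)"
    if U: "symmetric_of_order n U" and u: "u \<in> carrier_vec l" for U u
  proof -
    have "U \<in> carrier_mat n n" "transpose_mat U = U"
      using U unfolding symmetric_of_order_def by blast+
    then show ?thesis
      by (simp add: symmetric_of_order_def transpose_append_diag[OF _ u] u)
  qed
  have "symmetric_of_order (n + l) C\<^sub>0"
    unfolding C\<^sub>0_def by (rule sym[OF assms(1) g])
  moreover have "\<forall>i. symmetric_of_order (n + l) (A\<^sub>0 i)"
    unfolding A\<^sub>0_def by (intro allI sym assms(2) h)
  moreover have "1 \<le> n + l" using l by simp
  ultimately show ?thesis using spectrahedron TDI
    by (intro exI[of _ "n + l"] exI[of _ C\<^sub>0] exI[of _ A\<^sub>0] conjI)
qed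

end
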